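(* Let $\mathcal X=[d]$, let $\mathcal Y$ be a finite set, and let $L\ge 1$. The Gram determinant score $\Gamma(PQ)=\det\big((PQ)^\top(PQ)\big)$ preserves 1. the exact match ordering under $\mathcal P_{\mathrm{indep}}$ and $\mathcal Q_{\mathrm{nonperm}}$; 2. the Blackwell dominant ordering under $\mathcal P_{\mathrm{indep}}$ and $\mathcal Q_{\mathrm{reg}}$; 3. the $\frac{1}{4L\Delta}$-$\mathrm{dist}$ ordering under $\mathcal P_{\mathrm{indep}}$ and $\mathcal Q_{L,\,1/(64L^2d^2)}$, for every distance function $\mathrm{dist}$, where $\Delta=\dfrac{\max_{a,b\in\mathcal X}\mathrm{dist}(a,b)}{\min_{a\ne b\in\mathcal X}\mathrm{dist}(a,b)}$.
   Context: Datasets are vectors $x=(x_1,\dots,x_N)\in\mathcal X^N$, $N\ge1$. For true data $x$ and reported data $\hat x$ in $\mathcal X^N$, the misreport matrix is $Q\in\mathbb R^{d\times d}$, $Q(i,j)=\frac1N\#\{n: x_n=i,\hat x_n=j\}$; $q_x(i)=\frac1N\#\{n:x_n=i\}$. When every label of $\mathcal X$ occurs in $x$, define $Q_{\hat x\mid x}(i,j)=\frac{\#\{n:x_n=j,\hat x_n=i\}}{\#\{n:x_n=j\}}$ (column stochastic). For a second report $\hat x'$ of the same $x$, $Q'$ and $Q'_{\hat x\mid x}$ denote the corresponding matrices of $(x,\hat x')$. An experiment is a column-stochastic matrix $P\in\mathbb R^{|\mathcal Y|\times d}$ (column $P_a$, $a\in\mathcal X$, is a probability distribution on $\mathcal Y$).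 $\mathcal P_{\mathrm{indep}}$ is the set of experiments with linearly independent columns. Classes of misreport matrices: - $\mathcal Q_{\mathrm{nonperm}}$: those $Q$ whose associated $Q_{\hat x\mid x}$ is not a permutation matrix different from the identity. - $\mathcal Q_{\mathrm{reg}}$: $Q$ is invertible and (row) diagonally maximal, i.e. $Q(i,j)\le Q(i,i)$ for all $i,j$. - $\mathcal Q_{L,\delta}$: $Q$ is (row) diagonally dominant, i.e. $\sum_{j\ne i}|Q(i,j)|\le|Q(i,i)|$ for all $i$; $x$ is $L$-balanced, i.e. $q_x(a)\le Lq_x(b)$ for all $a,b\in\mathcal X$; and $\#\{n:\hat x_n\ne x_n\}\le N\delta$. Orderings of reports relative to true data $x$: - Exact match: $\hat x\succ\hat x'$ iff $\hat x=x$ and $\hat x'\ne x$. - Blackwell dominant: $\hat x\succ\hat x'$ iff $Q,Q'\in\mathcal Q_{\mathrm{reg}}$ and there is a column-stochastic matrix $T\neq I$ with $TQ_{\hat x\mid x}=Q'_{\hat x\mid x}$. - $\alpha$-dist ($\alpha\in(0,1]$): a distance function $\mathrm{dist}:\mathcal X\times\mathcal X\to\mathbb R$ is symmetric with $\mathrm{dist}(a,a)=0$ and $\mathrm{dist}(a,b)>0$ for $a\ne b$; $\hat x\succ\hat x'$ iff $\sum_n\mathrm{dist}(\hat x_n,x_n)<\alpha\sum_n\mathrm{dist}(\hat x'_n,x_n)$. The score $\Gamma$ preserves an ordering under $\mathcal P$ and $\mathcal Q$ if $\Gamma(PQ)>\Gamma(PQ')$ for all $P\in\mathcal P$ and all $x,\hat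 x,\hat x'$ of a common length $N\ge1$ with $\hat x\succ\hat x'$ (relative to $x$) and $Q,Q'\in\mathcal Q$.
   Formalization: Item 2 fails when diagonal ties make two reports Blackwell dominant over each other; it is proved for pairs related in one direction only (with Q_reg as stated), and also for the full ordering when Q(i,j) < Q(i,i) for all j ≠ i. *)

theory Defs
  imports "HOL-Analysis.Analysis"
begin

(* The label set [d] is a finite type 'd with d = CARD('d), the signal set is a finite type 'y.
   A dataset of length N is a list of length N.  The definitions below that take several
   datasets are meant for lists of one common positive length, as preserves requires. *)

definition misreport :: "'d::finite list \<Rightarrow> 'd list \<Rightarrow> real^'d^'d" where
  "misreport x xh =
     (\<chi> i j. real (card {n. n < length x \<and> x ! n = i \<and> xh ! n = j}) / real (length x))"

definition label_freq :: "'d list \<Rightarrow> 'd \<Rightarrow> real" where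
  "label_freq x i = real (card {n. n < length x \<and> x ! n = i}) / real (length x)"

(* The index order is opposite to that of misreport: here the column is the true label.
   Meaningful only if every label occurs in x; otherwise some columns are 0. *)
definition cond_misreport :: "'d::finite list \<Rightarrow> 'd list \<Rightarrow> real^'d^'d" where
  "cond_misreport x xh =
     (\<chi> i j. real (card {n. n < length x \<and> x ! n = j \<and> xh ! n = i})
            / real (card {n. n < length x \<and> x ! n = j}))"

definition column_stochastic :: "real^'n^'m \<Rightarrow> bool" where
  "column_stochastic M \<longleftrightarrow>
     (\<forall>i j. 0 \<le> M $ i $ j) \<and> (\<forall>j. (\<Sum>i\<in>UNIV. M $ i $ j) = 1)"

definition permutation_matrix :: "real^'n^'n \<Rightarrow> bool" where
  "permutation_matrix M \<longleftrightarrow>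
     (\<exists>p. p permutes UNIV \<and> M = (\<chi> i j. if i = p j then 1 else 0))"

(* Injectivity is needed because columns P is a set and forgets repeated columns. *)
definition P_indep :: "(real^'d^'y) set" where
  "P_indep = {P. column_stochastic P \<and> inj (\<lambda>a. column a P) \<and> independent (columns P)}"

(* The condition set x = UNIV is what makes the conditional matrix exist. *)
definition Q_nonperm :: "(real^'d^'d) set" where
  "Q_nonperm = {misreport x xh | x xh. x \<noteq> [] \<and> length xh = length x \<and> set x = UNIV \<and>
     \<not> (permutation_matrix (cond_misreport x xh) \<and> cond_misreport x xh \<noteq> mat 1)}"

definition Q_reg :: "(real^'d^'d) set" where
  "Q_reg = {Q. invertible Q \<and> (\<forall>i j. Q $ i $ j \<le> Q $ i $ i)}"

definition Q_reg_strict :: "(real^'d^'d) set" where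
  "Q_reg_strict = {Q. invertible Q \<and> (\<forall>i j. i \<noteq> j \<longrightarrow> Q $ i $ j < Q $ i $ i)}"

definition row_diag_dominant :: "real^'d^'d \<Rightarrow> bool" where
  "row_diag_dominant Q \<longleftrightarrow> (\<forall>i. (\<Sum>j\<in>UNIV - {i}. \<bar>Q $ i $ j\<bar>) \<le> \<bar>Q $ i $ i\<bar>)"

definition balanced :: "real \<Rightarrow> 'd list \<Rightarrow> bool" where
  "balanced L x \<longleftrightarrow> (\<forall>a b. label_freq x a \<le> L * label_freq x b)"

definition Q_bal :: "real \<Rightarrow> real \<Rightarrow> (real^'d^'d) set" where
  "Q_bal L \<delta> = {misreport x xh | x xh. x \<noteq> [] \<and> length xh = length x \<and>
     row_diag_dominant (misreport x xh) \<and> balanced L x \<and>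
     real (card {n. n < length x \<and> xh ! n \<noteq> x ! n}) \<le> real (length x) * \<delta>}"

(* An ordering is a ternary relation: ord x xh xh' says that, relative to the true data x,
   the report xh is ranked above the report xh'. *)
type_synonym 'd report_order = "'d list \<Rightarrow> 'd list \<Rightarrow> 'd list \<Rightarrow> bool"

definition exact_match :: "'d report_order" where
  "exact_match x xh xh' \<longleftrightarrow> xh = x \<and> xh' \<noteq> x"

(* Invertibility in Q_reg forces every label to occur in x. *)
definition blackwell_dominant :: "'d::finite report_order" where
  "blackwell_dominant x xh xh' \<longleftrightarrow> misreport x xh \<in> Q_reg \<and> misreport x xh' \<in> Q_reg \<and>
     (\<exists>T :: real^'d^'d. column_stochastic T \<and> T \<noteq> mat 1 \<and>
        T ** cond_misreport x xh = cond_misreport x xh')"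

(* With ties on the diagonal, blackwell_dominant can hold in both directions, and then no score
   can be strictly larger on both sides.  Example with labels 1, 2, 3:
     x = [1,1,2,2,3,3],  xh = [1,2,2,3,3,1],  xh' = [1,3,1,2,2,3].
   Both misreport matrices are in Q_reg, and T can be a cyclic permutation matrix in one
   direction and its inverse in the other.  The asymmetric part removes exactly such pairs;
   strict diagonal maximality (Q_reg_strict) also excludes them. *)
definition asymmetric_part :: "'d report_order \<Rightarrow> 'd report_order" where
  "asymmetric_part ord x xh xh' \<longleftrightarrow> ord x xh xh' \<and> \<not> ord x xh' xh"

definition distance_function :: "('d \<Rightarrow> 'd \<Rightarrow> real) \<Rightarrow> bool" where
  "distance_function D \<longleftrightarrow>
     (\<forall>a b. D a b = D b a) \<and> (\<forall>a. D a a = 0) \<and> (\<forall>a b. a \<noteq> b \<longrightarrow> 0 < D a b)"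

definition dist_order :: "real \<Rightarrow> ('d \<Rightarrow> 'd \<Rightarrow> real) \<Rightarrow> 'd report_order" where
  "dist_order \<alpha> D x xh xh' \<longleftrightarrow>
     (\<Sum>n<length x. D (xh ! n) (x ! n)) < \<alpha> * (\<Sum>n<length x. D (xh' ! n) (x ! n))"

(* If there is only one label, the minimum is over the empty set and hence unspecified; the order
   dist_order \<alpha> D is then empty for every \<alpha>, since D vanishes. *)
definition distance_ratio :: "('d::finite \<Rightarrow> 'd \<Rightarrow> real) \<Rightarrow> real" where
  "distance_ratio D = Max {D a b | a b. True} / Min {D a b | a b. a \<noteq> b}"

definition gram_score :: "real^'d^'y \<Rightarrow> real" where
  "gram_score M = det (transpose M ** M)"

definition preserves ::
  "(real^'d^'y \<Rightarrow> real) \<Rightarrow> 'd::finite report_order \<Rightarrow> (real^'d^'y) set \<Rightarrow> (real^'d^'d) set \<Rightarrow> bool" where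
  "preserves \<Gamma> ord \<P> \<Q> \<longleftrightarrow>
     (\<forall>P\<in>\<P>. \<forall>x xh xh'. x \<noteq> [] \<and> length xh = length x \<and> length xh' = length x \<and>
        ord x xh xh' \<and> misreport x xh \<in> \<Q> \<and> misreport x xh' \<in> \<Q> \<longrightarrow>
        \<Gamma> (P ** misreport x xh) > \<Gamma> (P ** misreport x xh'))"

end

(* Gamma(PQ) = det(P^T P) (det Q)^2 with det(P^T P) > 0, so only |det Q| matters, and
   Q^T = Q_{xh|x} diag(q_x).  For a column-stochastic matrix A, give a map f : [d] -> [d] the weight
   prod_j A(f j, j).  All weights together sum to 1, while det A is the signed sum over bijections
   only.  Hence |det A| <= 1, with equality only for permutation matrices, which yields the exact
   match and Blackwell orderings.  With E = sum_j (1 - A(j,j)), the same count gives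
   1 - 2E <= det A and |det A| <= 1 - E(1 - E).  In the distance ordering, balancedness makes E
   comparable to the fraction of misreports up to a factor L, so that E < E'/4 with E' small, and
   the two bounds separate the determinants. *)
theory Submission
  imports Defs
begin

section \<open>Positivity of the Gram determinant and reduction of the score to |det Q|\<close>

lemma det_gram_pos:
  fixes P :: "real^'d^'y"
  assumes "P \<in> P_indep"
  shows "0 < det (transpose P ** P)"
proof -
  have inj: "inj (\<lambda>a. column a P)" and ind: "independent (columns P)"
    using assms by (auto simp: P_indep_def)
  have cols: "columns P = range (\<lambda>a. column a P)"
    by (auto simp: columns_def)
  then have fin: "finite (columns P)"
    by simp
  have ker: "v = 0" if "P *v v = 0" for v
  proof -
    \<comment> \<open>Independence speaks about coefficient functions on the set of columns, so the
      coordinates of \<open>v\<close> are carried over to that set; this is unambiguous because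
      distinct labels have distinct columns.\<close>
    define u where "u = (\<lambda>w. v $ (inv (\<lambda>a. column a P) w))"
    have u: "u (column a P) = v $ a" for a
      unfolding u_def using inv_f_f[OF inj] by simp
    have "(\<Sum>w\<in>columns P. u w *\<^sub>R w) = (\<Sum>a\<in>UNIV. v $ a *s column a P)"
      unfolding cols by (subst sum.reindex[OF inj]) (simp add: u scalar_mult_eq_scaleR)
    also have "\<dots> = 0"
      using that by (simp add: matrix_mult_sum)
    finally have sum0: "(\<Sum>w\<in>columns P. u w *\<^sub>R w) = 0" .
    have "u w = 0" if "w \<in> columns P" for w
      using independentD[OF ind fin subset_refl sum0 that] .
    then have "v $ a = 0" for a
      using u[of a] by (auto simp: cols)
    then show ?thesis
      by (simp add: vec_eq_iff)
  qed
  \<comment> \<open>The segment from the identity to \<open>transpose P ** P\<close> consists of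
    positive definite matrices. Its determinant starts at 1 and never vanishes, so by the
    intermediate value theorem it is still positive at the other end.\<close>
  define M where "M = (\<lambda>t. (1 - t) *\<^sub>R mat 1 + t *\<^sub>R (transpose P ** P))"
  have M_nz: "det (M t) \<noteq> 0" if t: "0 \<le> t" "t \<le> 1" for t
  proof -
    have "v = 0" if v: "M t *v v = 0" for v
    proof -
      have "M t *v v = (1 - t) *\<^sub>R v + t *\<^sub>R (transpose P *v (P *v v))"
        unfolding M_def
        by (simp add: matrix_vector_mult_add_rdistrib scaleR_matrix_vector_assoc[symmetric]
            matrix_vector_mul_assoc)
      then have "0 = v \<bullet> ((1 - t) *\<^sub>R v + t *\<^sub>R (transpose P *v (P *v v)))"
        using v by simp
      also have "\<dots> = (1 - t) * (v \<bullet> v) + t * (v \<bullet> (transpose P *v (P *v v)))"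
        by (simp add: inner_add_right)
      also have "v \<bullet> (transpose P *v (P *v v)) = (P *v v) \<bullet> (P *v v)"
        by (metis dot_lmul_matrix vector_transpose_matrix)
      finally have eq: "(1 - t) * (v \<bullet> v) + t * ((P *v v) \<bullet> (P *v v)) = 0"
        by simp
      have "(1 - t) * (v \<bullet> v) = 0" "t * ((P *v v) \<bullet> (P *v v)) = 0"
        using eq t add_nonneg_eq_0_iff[of "(1 - t) * (v \<bullet> v)" "t * ((P *v v) \<bullet> (P *v v))"]
        by simp_all
      then show "v = 0"
        \<comment> \<open>At \<open>t = 0\<close> the first summand alone gives
          \<open>v = 0\<close>; for positive \<open>t\<close> the second gives
          \<open>P *v v = 0\<close>.\<close>
        using ker by (cases "t = 0") auto
    qed
    then show ?thesis
      by (metis matrix_left_invertible_ker invertible_det_nz invertible_left_inverse)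
  qed
  have cont: "continuous_on {0..1} (\<lambda>t. det (M t))"
    unfolding det_def M_def by (intro continuous_intros)
  have M0: "det (M 0) = 1" and M1: "M 1 = transpose P ** P"
    by (simp_all add: M_def)
  show ?thesis
  proof (rule ccontr)
    assume "\<not> 0 < det (transpose P ** P)"
    then have "det (M 1) \<le> 0" "0 \<le> det (M 0)"
      by (simp_all add: M0 M1)
    from IVT2'[OF this _ cont] obtain t where "0 \<le> t" "t \<le> 1" "det (M t) = 0"
      by auto
    then show False
      using M_nz by blast
  qed
qed

lemma gram_score_mult:
  fixes P :: "real^'d^'y" and Q :: "real^'d^'d"
  shows "gram_score (P ** Q) = det (transpose P ** P) * (det Q)\<^sup>2"
proof -
  have "transpose (P ** Q) ** (P ** Q) = transpose Q ** ((transpose P ** P) ** Q)"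
    by (simp add: matrix_transpose_mul matrix_mul_assoc)
  then show ?thesis
    by (simp add: gram_score_def det_mul power2_eq_square)
qed

text \<open>Both scores carry the same positive factor from \<open>P\<close>, so it cancels, and all
  later work concerns misreport matrices only.\<close>

lemma gram_score_less_iff:
  fixes P :: "real^'d^'y" and Q Q' :: "real^'d^'d"
  assumes "P \<in> P_indep"
  shows "gram_score (P ** Q') < gram_score (P ** Q) \<longleftrightarrow> \<bar>det Q'\<bar> < \<bar>det Q\<bar>"
proof -
  have "\<bar>det Q'\<bar> < \<bar>det Q\<bar> \<longleftrightarrow> (det Q')\<^sup>2 < (det Q)\<^sup>2"
    using abs_le_square_iff[of "det Q" "det Q'"] by linarith
  then show ?thesis
    using det_gram_pos[OF assms] by (simp add: gram_score_mult)
qed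

section \<open>Determinant bounds for column-stochastic matrices\<close>

definition path_weight :: "real^'n^'n \<Rightarrow> ('n \<Rightarrow> 'n) \<Rightarrow> real" where
  "path_weight A f = (\<Prod>j\<in>UNIV. A $ f j $ j)"

text \<open>The transpose is taken because \<open>det_def\<close> lets the permutation choose a
  column in each row, whereas stochasticity calls for choosing a row in each column.\<close>

lemma det_path_weight:
  "det A = (\<Sum>p | p permutes UNIV. of_int (sign p) * path_weight A p)"
  by (subst det_transpose[symmetric]) (simp add: det_def path_weight_def transpose_def)

lemma column_stochastic_entry_le_1:
  assumes "column_stochastic A"
  shows "A $ i $ j \<le> 1"
proof -
  have "A $ i $ j \<le> (\<Sum>i\<in>UNIV. A $ i $ j)"
    using assms by (intro member_le_sum) (auto simp: column_stochastic_def)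
  then show ?thesis
    using assms by (simp add: column_stochastic_def)
qed

context
  fixes A :: "real^'n^'n"
  assumes stoch: "column_stochastic A"
begin

lemma path_weight_nonneg: "0 \<le> path_weight A f"
  using stoch by (auto simp: path_weight_def column_stochastic_def intro: prod_nonneg)

text \<open>If each column \<open>j\<close> independently draws a label from its own distribution,
  then \<open>path_weight A f\<close> is the probability that the draws form the map
  \<open>f\<close>.\<close>

lemma sum_path_weight: "(\<Sum>f\<in>UNIV. path_weight A f) = 1"
proof -
  have "(\<Prod>j\<in>UNIV. \<Sum>i\<in>UNIV. A $ i $ j) = (\<Sum>f\<in>UNIV. path_weight A f)"
    by (subst prod_sum_PiE) (simp_all add: path_weight_def PiE_UNIV_domain)
  then show ?thesis
    using stoch by (simp add: column_stochastic_def)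
qed

lemma sum_signed_path_weight_le:
  "\<bar>\<Sum>p\<in>S. of_int (sign p) * path_weight A p\<bar> \<le> (\<Sum>p\<in>S. path_weight A p)"
  by (rule order_trans[OF sum_abs])
    (auto simp: abs_mult sign_def path_weight_nonneg intro!: sum_mono)

text \<open>By the triangle inequality |det A| is at most the total weight of the permutations, and
  non-injective maps occupy a disjoint part of the total mass 1.\<close>

lemma abs_det_plus_nonpermutation_weight_le:
  fixes S :: "('n \<Rightarrow> 'n) set"
  assumes "\<And>f. f \<in> S \<Longrightarrow> \<not> inj f"
  shows "\<bar>det A\<bar> + (\<Sum>f\<in>S. path_weight A f) \<le> 1"
proof -
  have disj: "{p. p permutes UNIV} \<inter> S = {}"
    using assms permutes_inj by blast
  have "\<bar>det A\<bar> + sum (path_weight A) S \<le> sum (path_weight A) {p. p permutes UNIV} + sum (path_weight A) S"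
    unfolding det_path_weight using sum_signed_path_weight_le by auto
  also have "\<dots> = sum (path_weight A) ({p. p permutes UNIV} \<union> S)"
    using disj by (intro sum.union_disjoint[symmetric]) auto
  also have "\<dots> \<le> sum (path_weight A) UNIV"
    by (intro sum_mono2) (auto simp: path_weight_nonneg)
  finally show ?thesis
    by (simp add: sum_path_weight)
qed

text \<open>If some column has two positive entries, then redirecting one label within the support
  of \<open>A\<close> turns a bijection into a non-injective map, so some non-injective map has positive weight.\<close>
lemma column_stochastic_abs_det_less_1:
  assumes "\<not> permutation_matrix A"
  shows "\<bar>det A\<bar> < 1"
proof (rule ccontr)
  assume "\<not> \<bar>det A\<bar> < 1"
  \<comment> \<open>A non-injective map running through positive entries would take positive mass
    away from the permutations and push |det A| below 1.\<close>
  have inj: "inj f" if pos: "\<And>j. 0 < A $ f j $ j" for f :: "'n \<Rightarrow> 'n"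
  proof (rule ccontr)
    assume "\<not> inj f"
    then have "\<bar>det A\<bar> + path_weight A f \<le> 1"
      using abs_det_plus_nonpermutation_weight_le[of "{f}"] by simp
    moreover have "0 < path_weight A f"
      unfolding path_weight_def using pos by (intro prod_pos) simp
    ultimately show False
      using \<open>\<not> \<bar>det A\<bar> < 1\<close> by simp
  qed
  have nonneg: "0 \<le> A $ i $ j" and colsum: "(\<Sum>i\<in>UNIV. A $ i $ j) = 1" for i j
    using stoch by (auto simp: column_stochastic_def)
  have "\<exists>i. 0 < A $ i $ j" for j
  proof (rule ccontr)
    assume "\<nexists>i. 0 < A $ i $ j"
    then have "A $ i $ j = 0" for i
      using nonneg[of i j] by (intro antisym) (auto simp: not_less)
    then show False
      using colsum[of j] by simp
  qed
  then obtain f where f: "0 < A $ f j $ j" for j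
    by metis
  have injf: "inj f"
    by (intro inj f)
  then have surjf: "surj f"
    by (simp add: finite_UNIV_inj_surj)
  have zero: "A $ i $ j = 0" if "i \<noteq> f j" for i j
  proof (rule ccontr)
    assume "A $ i $ j \<noteq> 0"
    then have "0 < A $ i $ j"
      using nonneg[of i j] by simp
    then have "inj (f(j := i))"
      by (intro inj) (simp add: f)
    moreover obtain k where k: "i = f k"
      using surjf by blast
    ultimately show False
      using that by (metis fun_upd_other fun_upd_same injD)
  qed
  have one: "A $ f j $ j = 1" for j
  proof -
    have "(\<Sum>i\<in>UNIV. A $ i $ j) = (\<Sum>i\<in>UNIV. if i = f j then A $ f j $ j else 0)"
      using zero by (intro sum.cong) auto
    then show ?thesis
      using colsum[of j] by simp
  qed
  have "f permutes UNIV"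
    using injf surjf by (intro bij_imp_permutes) (simp_all add: bij_def)
  moreover have "A = (\<chi> i j. if i = f j then 1 else 0)"
    using zero one by (simp add: vec_eq_iff)
  ultimately show False
    using assms by (auto simp: permutation_matrix_def)
qed

text \<open>In probabilistic terms this is the union bound over the columns in \<open>S\<close> that
  leave the diagonal.\<close>

lemma prod_diag_ge: "1 - (\<Sum>j\<in>S. 1 - A $ j $ j) \<le> (\<Prod>j\<in>S. A $ j $ j)"
proof -
  have "1 - (\<Sum>j\<in>S. 1 - A $ j $ j) \<le> (\<Prod>j\<in>S. 1 - (1 - A $ j $ j))"
    using stoch column_stochastic_entry_le_1[OF stoch]
    by (intro Weierstrass_prod_ineq) (auto simp: column_stochastic_def)
  then show ?thesis
    by simp
qed

text \<open>The identity contributes its weight w with sign +1, and the other permutations subtract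
  at most 1 - w. Hence the determinant is at least 2w - 1, while w is at least 1 minus the total
  deficit.\<close>

lemma det_ge_diag_deficit: "1 - 2 * (\<Sum>j\<in>UNIV. 1 - A $ j $ j) \<le> det A"
proof -
  let ?P = "{p :: 'n \<Rightarrow> 'n. p permutes UNIV}"
  have "id \<in> ?P"
    by (simp add: permutes_id)
  then have "det A = path_weight A id + (\<Sum>p\<in>?P - {id}. of_int (sign p) * path_weight A p)"
    unfolding det_path_weight by (subst sum.remove[of _ id]) (simp_all add: sign_id)
  moreover have "(\<Sum>p\<in>?P - {id}. path_weight A p) \<le> (\<Sum>p\<in>UNIV - {id}. path_weight A p)"
    by (intro sum_mono2) (auto simp: path_weight_nonneg)
  moreover have "(\<Sum>p\<in>UNIV - {id}. path_weight A p) = 1 - path_weight A id"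
    using sum_path_weight by (simp add: sum_diff1)
  ultimately have "2 * path_weight A id - 1 \<le> det A"
    using sum_signed_path_weight_le[of "?P - {id}"] by simp
  then show ?thesis
    using prod_diag_ge[of UNIV] by (simp add: path_weight_def)
qed

text \<open>A map that moves exactly one label is not injective; the upper bound comes from dropping the
  weight of all these maps.\<close>
lemma abs_det_le_diag_deficit:
  fixes E :: real
  defines "E \<equiv> \<Sum>j\<in>UNIV. 1 - A $ j $ j"
  shows "\<bar>det A\<bar> \<le> 1 - E * (1 - E)"
proof -
  have diag: "0 \<le> 1 - A $ j $ j" "0 \<le> A $ j $ j" for j
    using column_stochastic_entry_le_1[OF stoch] stoch by (auto simp: column_stochastic_def)
  \<comment> \<open>\<open>g\<close> sends (j, k) to the map that moves only \<open>j\<close>,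
    namely to \<open>k\<close>. The restriction to k different from j in \<open>I\<close> makes this
    parametrization injective.\<close>
  define g where "g = (\<lambda>(j :: 'n, k). id(j := k))"
  define I where "I = (SIGMA j:UNIV. UNIV - {j :: 'n})"
  have inj: "inj_on g I"
    by (auto simp: inj_on_def g_def I_def fun_eq_iff split: if_splits)
  have "\<not> inj (id(j := k))" if "k \<noteq> j" for j k :: 'n
    using that by (auto simp: inj_def)
  then have "\<bar>det A\<bar> + (\<Sum>f\<in>g ` I. path_weight A f) \<le> 1"
    by (intro abs_det_plus_nonpermutation_weight_le) (auto simp: g_def I_def)
  moreover have "(\<Sum>f\<in>g ` I. path_weight A f) =
      (\<Sum>j\<in>UNIV. (1 - A $ j $ j) * (\<Prod>i\<in>UNIV - {j}. A $ i $ i))"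
  proof -
    have w: "path_weight A (id(j := k)) = A $ k $ j * (\<Prod>i\<in>UNIV - {j}. A $ i $ i)" for j k
    proof -
      have "path_weight A (id(j := k)) =
          A $ k $ j * (\<Prod>i\<in>UNIV - {j}. A $ (id(j := k)) i $ i)"
        unfolding path_weight_def by (subst prod.remove[of _ j]) simp_all
      also have "(\<Prod>i\<in>UNIV - {j}. A $ (id(j := k)) i $ i) = (\<Prod>i\<in>UNIV - {j}. A $ i $ i)"
        by (intro prod.cong) auto
      finally show ?thesis .
    qed
    have off: "(\<Sum>k\<in>UNIV - {j}. A $ k $ j) = 1 - A $ j $ j" for j
      using stoch by (simp add: sum_diff1 column_stochastic_def)
    have "(\<Sum>f\<in>g ` I. path_weight A f) =
        (\<Sum>(j, k)\<in>I. A $ k $ j * (\<Prod>i\<in>UNIV - {j}. A $ i $ i))"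
      by (subst sum.reindex[OF inj]) (auto simp: g_def w intro!: sum.cong)
    also have "\<dots> = (\<Sum>j\<in>UNIV. \<Sum>k\<in>UNIV - {j}. A $ k $ j * (\<Prod>i\<in>UNIV - {j}. A $ i $ i))"
      unfolding I_def by (subst sum.Sigma) auto
    finally show ?thesis
      by (simp add: sum_distrib_right[symmetric] off)
  qed
  \<comment> \<open>The deficits outside column \<open>j\<close> sum to at most \<open>E\<close>, so
    every remaining diagonal product is at least 1 - E; weighting by the deficits then yields E(1 -
    E).\<close>
  moreover have "(\<Sum>j\<in>UNIV. (1 - A $ j $ j) * (1 - E)) \<le>
      (\<Sum>j\<in>UNIV. (1 - A $ j $ j) * (\<Prod>i\<in>UNIV - {j}. A $ i $ i))"
  proof (intro sum_mono mult_left_mono)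
    fix j
    have "(\<Sum>i\<in>UNIV - {j}. 1 - A $ i $ i) \<le> E"
      unfolding E_def using diag by (intro sum_mono2) auto
    then show "1 - E \<le> (\<Prod>i\<in>UNIV - {j}. A $ i $ i)"
      using prod_diag_ge[of "UNIV - {j}"] by linarith
  qed (use diag in auto)
  ultimately show ?thesis
    by (simp add: sum_distrib_right[symmetric] E_def)
qed

end

text \<open>Let E and F be the deficits of \<open>A\<close> and \<open>B\<close>. From F \<le> 1/2
  one gets |det B| \<le> 1 - F(1 - F) \<le> 1 - F/2, and the factor 4 puts this strictly below 1 -
  2E \<le> det A.\<close>

lemma abs_det_less_of_diag_deficit:
  fixes A B :: "real^'n^'n"
  assumes A: "column_stochastic A" and B: "column_stochastic B"
    and less: "4 * (\<Sum>j\<in>UNIV. 1 - A $ j $ j) < (\<Sum>j\<in>UNIV. 1 - B $ j $ j)"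
    and small: "(\<Sum>j\<in>UNIV. 1 - B $ j $ j) \<le> 1 / 2"
  shows "\<bar>det B\<bar> < \<bar>det A\<bar>"
proof -
  define E F where "E = (\<Sum>j\<in>UNIV. 1 - A $ j $ j)" and "F = (\<Sum>j\<in>UNIV. 1 - B $ j $ j)"
  have "0 \<le> E"
    unfolding E_def using column_stochastic_entry_le_1[OF A] by (simp add: sum_nonneg)
  then have "F * (1 / 2) \<le> F * (1 - F)"
    using less small by (intro mult_left_mono) (auto simp: E_def F_def)
  moreover have "1 - 2 * E \<le> det A" "\<bar>det B\<bar> \<le> 1 - F * (1 - F)"
    using det_ge_diag_deficit[OF A] abs_det_le_diag_deficit[OF B] by (simp_all add: E_def F_def)
  ultimately show ?thesis
    using less by (simp add: E_def F_def)
qed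

section \<open>Misreport matrices, label frequencies and conditional matrices\<close>

lemma misreport_eq_sum:
  "misreport x xh $ i $ j = (\<Sum>n<length x. of_bool (x ! n = i \<and> xh ! n = j)) / real (length x)"
proof -
  have "{n. n < length x \<and> x ! n = i \<and> xh ! n = j} = {..<length x} \<inter> {n. x ! n = i \<and> xh ! n = j}"
    by auto
  then show ?thesis
    by (simp add: misreport_def)
qed

lemma label_freq_eq_sum:
  "label_freq x i = (\<Sum>n<length x. of_bool (x ! n = i)) / real (length x)"
proof -
  have "{n. n < length x \<and> x ! n = i} = {..<length x} \<inter> {n. x ! n = i}"
    by auto
  then show ?thesis
    by (simp add: label_freq_def)
qed

lemma misreport_nonneg: "0 \<le> misreport x xh $ i $ j"
  by (simp add: misreport_def)

lemma sum_misreport_row: "(\<Sum>j\<in>UNIV. misreport x xh $ i $ j) = label_freq x i"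
proof -
  have "(\<Sum>j\<in>UNIV. of_bool (x ! n = i \<and> xh ! n = j) :: real) = of_bool (x ! n = i)" for n
    by (cases "x ! n = i") (simp_all add: of_bool_def)
  then show ?thesis
    unfolding misreport_eq_sum label_freq_eq_sum sum_divide_distrib[symmetric]
    by (subst sum.swap) (simp only:)
qed

lemma sum_label_freq:
  fixes x :: "'d::finite list"
  assumes "x \<noteq> []"
  shows "(\<Sum>i\<in>UNIV. label_freq x i) = 1"
proof -
  have "(\<Sum>i\<in>UNIV. of_bool (x ! n = i) :: real) = 1" for n
    by (simp add: of_bool_def)
  then show ?thesis
    unfolding label_freq_eq_sum sum_divide_distrib[symmetric]
    using assms by (subst sum.swap) (simp del: sum_of_bool_eq)
qed

text \<open>A record contributes only at its true label, and there the two terms cancel exactly when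
  the report is truthful. In particular the fraction of misreports can be read off the misreport
  matrix.\<close>

lemma sum_misreport_diag:
  assumes "x \<noteq> []"
  shows "(\<Sum>i\<in>UNIV. label_freq x i - misreport x xh $ i $ i) =
         real (card {n. n < length x \<and> xh ! n \<noteq> x ! n}) / real (length x)"
proof -
  have eq: "{n. n < length x \<and> xh ! n \<noteq> x ! n} = {..<length x} \<inter> {n. xh ! n \<noteq> x ! n}"
    by auto
  have "(\<Sum>i\<in>UNIV. of_bool (x ! n = i) - of_bool (x ! n = i \<and> xh ! n = i) :: real)
      = of_bool (xh ! n \<noteq> x ! n)" for n
  proof -
    have "of_bool (x ! n = i) - of_bool (x ! n = i \<and> xh ! n = i) =
        (if i = x ! n then of_bool (xh ! n \<noteq> x ! n) else 0 :: real)" for i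
      by auto
    then show ?thesis
      by simp
  qed
  then have "(\<Sum>i\<in>UNIV. label_freq x i - misreport x xh $ i $ i) =
      (\<Sum>n<length x. of_bool (xh ! n \<noteq> x ! n)) / real (length x)"
    unfolding misreport_eq_sum label_freq_eq_sum diff_divide_distrib[symmetric]
      sum_subtractf[symmetric] sum_divide_distrib[symmetric]
    by (subst sum.swap) (simp only:)
  then show ?thesis
    by (simp add: eq)
qed

lemma label_freq_nonneg: "0 \<le> label_freq x i"
  by (simp add: label_freq_def)

lemma misreport_le_label_freq: "misreport x xh $ i $ j \<le> label_freq x i"
  unfolding sum_misreport_row[where xh = xh, symmetric]
  by (intro member_le_sum) (auto simp: misreport_nonneg)

lemma cond_misreport_eq:
  assumes "x \<noteq> []"
  shows "cond_misreport x xh $ i $ j = misreport x xh $ j $ i / label_freq x j"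
  using assms by (simp add: cond_misreport_def misreport_def label_freq_def)

text \<open>Membership in \<open>Q_nonperm\<close> or \<open>Q_bal\<close> only says that some
  dataset produces the matrix, possibly another one than the data at hand. Row sums recover the
  label frequencies, which lets properties pass between the two datasets.\<close>

lemma misreport_eq_imp_label_freq_eq:
  "misreport x xh = misreport y yh \<Longrightarrow> label_freq x = label_freq y"
  by (metis ext sum_misreport_row)

lemma misreport_eq_imp_cond_misreport_eq:
  assumes "misreport x xh = misreport y yh" "x \<noteq> []" "y \<noteq> []"
  shows "cond_misreport x xh = cond_misreport y yh"
  using misreport_eq_imp_label_freq_eq[OF assms(1)] assms
  by (simp add: vec_eq_iff cond_misreport_eq)

lemma transpose_misreport:
  assumes "x \<noteq> []"
  shows "transpose (misreport x xh) =
         cond_misreport x xh ** (\<chi> i j. if i = j then label_freq x i else 0)"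
proof -
  \<comment> \<open>For a label \<open>j\<close> absent from \<open>x\<close> the right side
    vanishes with its factor, and the left side lies between 0 and
    \<open>label_freq x j\<close>.\<close>
  have "misreport x xh $ j $ i = cond_misreport x xh $ i $ j * label_freq x j" for i j
    using misreport_le_label_freq[of x xh j i] misreport_nonneg[of x xh j i]
    by (cases "label_freq x j = 0") (simp_all add: cond_misreport_eq[OF assms])
  then show ?thesis
    by (simp add: vec_eq_iff transpose_def matrix_matrix_mult_def if_distrib cong: if_cong)
qed

text \<open>The product factor depends on \<open>x\<close> alone, so two reports of the same data
  compare through their conditional matrices.\<close>

lemma det_misreport:
  assumes "x \<noteq> []"
  shows "det (misreport x xh) = det (cond_misreport x xh) * (\<Prod>i\<in>UNIV. label_freq x i)"
proof -
  have "det (misreport x xh) = det (transpose (misreport x xh))"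
    by (rule det_transpose[symmetric])
  then show ?thesis
    unfolding transpose_misreport[OF assms] by (simp add: det_mul det_diagonal)
qed

lemma column_stochastic_cond_misreport:
  assumes "x \<noteq> []" and "\<And>i. 0 < label_freq x i"
  shows "column_stochastic (cond_misreport x xh)"
  unfolding column_stochastic_def
  using assms(2) less_imp_neq[OF assms(2)]
  by (auto simp: cond_misreport_eq[OF assms(1)] misreport_nonneg label_freq_nonneg
      sum_divide_distrib[symmetric] sum_misreport_row)

lemma cond_misreport_self:
  assumes "\<And>i. 0 < label_freq x i"
  shows "cond_misreport x x = mat 1"
proof -
  have "x \<noteq> []"
    using assms by (force simp: label_freq_def)
  moreover have "misreport x x $ i $ j = (if i = j then label_freq x i else 0)" for i j
    by (auto simp: misreport_eq_sum label_freq_eq_sum intro!: sum.neutral)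
  ultimately show ?thesis
    using less_imp_neq[OF assms] by (auto simp: vec_eq_iff cond_misreport_eq mat_def)
qed

text \<open>A position \<open>n\<close> with a wrong report makes the off-diagonal entry in row
  \<open>xh ! n\<close> and column \<open>x ! n\<close> nonzero.\<close>

lemma cond_misreport_neq_mat_1:
  assumes "length xh = length x" "xh \<noteq> x"
  shows "cond_misreport x xh \<noteq> mat 1"
proof -
  obtain n where n: "n < length x" "xh ! n \<noteq> x ! n"
    using assms nth_equalityI by metis
  have "card {m. m < length x \<and> x ! m = x ! n \<and> xh ! m = xh ! n} > 0"
    "card {m. m < length x \<and> x ! m = x ! n} > 0"
    using n by (auto simp only: card_gt_0_iff)
  then have "cond_misreport x xh $ (xh ! n) $ (x ! n) \<noteq> 0"
    unfolding cond_misreport_def by (simp del: card_gt_0_iff card_0_eq card_eq_0_iff)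
  then show ?thesis
    using n by (auto simp: mat_def)
qed

section \<open>The exact match ordering\<close>

lemma preserves_exact_match:
  "preserves (gram_score :: real^'d^'y \<Rightarrow> real) exact_match P_indep Q_nonperm"
  unfolding preserves_def
proof (intro ballI allI impI, elim conjE)
  fix P :: "real^'d^'y" and x xh xh' :: "'d list"
  assume P: "P \<in> P_indep" and x: "x \<noteq> []" and len: "length xh' = length x"
    and ord: "exact_match x xh xh'" and Q': "misreport x xh' \<in> Q_nonperm"
  have xh: "xh = x" and neq: "xh' \<noteq> x"
    using ord by (auto simp: exact_match_def)
  obtain y yh where y: "misreport x xh' = misreport y yh" "y \<noteq> []" "set y = UNIV"
    and nonperm: "\<not> (permutation_matrix (cond_misreport y yh) \<and> cond_misreport y yh \<noteq> mat 1)"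
    using Q' by (auto simp: Q_nonperm_def)
  have "0 < label_freq y i" for i
  proof -
    obtain n where "n < length y" "y ! n = i"
      using y(3) by (metis UNIV_I in_set_conv_nth)
    then have "{n. n < length y \<and> y ! n = i} \<noteq> {}"
      by auto
    then show ?thesis
      using y(2) by (simp add: label_freq_def card_gt_0_iff)
  qed
  then have pos: "0 < label_freq x i" for i
    using misreport_eq_imp_label_freq_eq[OF y(1)] by simp
  \<comment> \<open>The identity is ruled out because \<open>xh'\<close> differs from
    \<open>x\<close>, every other permutation matrix by \<open>nonperm\<close>. The truthful report
    has conditional determinant 1.\<close>
  have "\<not> permutation_matrix (cond_misreport x xh')"
    using nonperm cond_misreport_neq_mat_1[OF len neq]
      misreport_eq_imp_cond_misreport_eq[OF y(1) x y(2)] by simp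
  then have "\<bar>det (cond_misreport x xh')\<bar> < 1"
    by (intro column_stochastic_abs_det_less_1 column_stochastic_cond_misreport x pos)
  moreover have "0 < (\<Prod>i\<in>UNIV. label_freq x i)"
    using pos by (simp add: prod_pos)
  ultimately show "gram_score (P ** misreport x xh') < gram_score (P ** misreport x xh)"
    unfolding gram_score_less_iff[OF P]
    by (simp add: det_misreport[OF x] xh cond_misreport_self[OF pos] abs_mult)
qed

section \<open>The Blackwell dominant ordering\<close>

lemma garbling_transpose_misreport:
  fixes x xh xh' :: "'d::finite list"
  assumes x: "x \<noteq> []" and "T ** cond_misreport x xh = cond_misreport x xh'"
  shows "T ** transpose (misreport x xh) = transpose (misreport x xh')"
  using assms by (simp add: transpose_misreport matrix_mul_assoc)

text \<open>A permutation matrix moves the maximal diagonal entries to other positions of the same row,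
  so it must fix every label unless there are ties.\<close>
lemma permuted_diag_maximal:
  fixes Q Q' :: "real^'n^'n"
  assumes T: "T = (\<chi> i j. if i = p j then 1 else 0)" and p: "p permutes UNIV"
    and eq: "T ** transpose Q = transpose Q'"
    and Q: "\<And>i j. Q $ i $ j \<le> Q $ i $ i" and Q': "\<And>i j. Q' $ i $ j \<le> Q' $ i $ i"
  shows "Q $ i $ inv p i = Q $ i $ i"
proof -
  have entry: "Q' $ i $ j = Q $ i $ inv p j" for i j
  proof -
    have "transpose Q' $ j $ i = (\<Sum>k\<in>UNIV. (if j = p k then 1 else 0) * Q $ i $ k)"
      unfolding eq[symmetric] by (simp add: T matrix_matrix_mult_def transpose_def)
    also have "\<dots> = (\<Sum>k\<in>UNIV. if k = inv p j then Q $ i $ k else 0)"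
      using permutes_inverses[OF p] by (intro sum.cong) auto
    finally show ?thesis
      by (simp add: transpose_def)
  qed
  \<comment> \<open>The chain Q(i, i) = Q'(i, p i) \<le> Q'(i, i) = Q(i, inv p i) \<le> Q(i, i)
    closes up.\<close>
  show ?thesis
    using Q[of i "inv p i"] Q'[of i "p i"] by (simp add: entry permutes_inverses[OF p])
qed

text \<open>Garbling multiplies the determinant by \<open>det T\<close>, of absolute value below 1;
  the loss is strict because regularity makes \<open>misreport x xh\<close> invertible.\<close>

lemma gram_score_garbling_less:
  fixes P :: "real^'d^'y" and x xh xh' :: "'d list"
  assumes P: "P \<in> P_indep" and x: "x \<noteq> []"
    and Q: "misreport x xh \<in> Q_reg"
    and T: "column_stochastic T" "T ** cond_misreport x xh = cond_misreport x xh'"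
    and nperm: "\<not> permutation_matrix T"
  shows "gram_score (P ** misreport x xh') < gram_score (P ** misreport x xh)"
proof -
  have "det (T ** transpose (misreport x xh)) = det (transpose (misreport x xh'))"
    using garbling_transpose_misreport[OF x T(2)] by simp
  then have "det (misreport x xh') = det T * det (misreport x xh)"
    by (simp add: det_mul det_transpose)
  moreover have "det (misreport x xh) \<noteq> 0"
    using Q by (simp add: Q_reg_def invertible_det_nz)
  ultimately show ?thesis
    unfolding gram_score_less_iff[OF P]
    using column_stochastic_abs_det_less_1[OF T(1) nperm] by (simp add: abs_mult)
qed

text \<open>If \<open>T\<close> were a permutation matrix, its transpose would be a
  column-stochastic inverse different from the identity. It would garble \<open>xh'\<close> back
  into \<open>xh\<close>, and dominance would hold in both directions.\<close>

lemma preserves_asymmetric_blackwell_dominant: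
  "preserves (gram_score :: real^'d^'y \<Rightarrow> real) (asymmetric_part blackwell_dominant) P_indep Q_reg"
  unfolding preserves_def
proof (intro ballI allI impI, elim conjE)
  fix P :: "real^'d^'y" and x xh xh' :: "'d list"
  assume P: "P \<in> P_indep" and x: "x \<noteq> []"
    and ord: "asymmetric_part blackwell_dominant x xh xh'"
    and Q: "misreport x xh \<in> Q_reg" "misreport x xh' \<in> Q_reg"
  obtain T where T: "column_stochastic T" "T \<noteq> mat 1"
    "T ** cond_misreport x xh = cond_misreport x xh'"
    using ord by (auto simp: asymmetric_part_def blackwell_dominant_def)
  have "\<not> permutation_matrix T"
  proof
    assume "permutation_matrix T"
    then obtain p where p: "p permutes UNIV" and Tp: "T = (\<chi> i j. if i = p j then 1 else 0)"
      by (auto simp: permutation_matrix_def)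
    have rowsum: "(\<Sum>k\<in>UNIV. T $ i $ k) = 1" for i
    proof -
      have "(\<Sum>k\<in>UNIV. T $ i $ k) = (\<Sum>k\<in>UNIV. if k = inv p i then 1 else 0)"
        unfolding Tp using permutes_inverses[OF p] by (intro sum.cong) auto
      then show ?thesis
        by simp
    qed
    have "(transpose T ** T) $ i $ j = mat 1 $ i $ j" for i j
    proof -
      have "(transpose T ** T) $ i $ j = (\<Sum>k\<in>UNIV. if k = p i then of_bool (p i = p j) else 0)"
        unfolding Tp matrix_matrix_mult_def transpose_def vec_lambda_beta
        by (intro sum.cong) auto
      then show ?thesis
        using permutes_inj[OF p] by (simp add: mat_def inj_eq)
    qed
    then have "transpose T ** T = mat 1"
      by (simp add: vec_eq_iff)
    then have "transpose T ** cond_misreport x xh' = cond_misreport x xh"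
      by (simp add: T(3)[symmetric] matrix_mul_assoc)
    moreover have "column_stochastic (transpose T)"
      using rowsum T(1) by (auto simp: column_stochastic_def transpose_def)
    moreover have "transpose T \<noteq> mat 1"
      using T(2) by (metis transpose_mat transpose_transpose)
    ultimately have "blackwell_dominant x xh' xh"
      using Q by (auto simp: blackwell_dominant_def)
    then show False
      using ord by (simp add: asymmetric_part_def)
  qed
  then show "gram_score (P ** misreport x xh') < gram_score (P ** misreport x xh)"
    using gram_score_garbling_less[OF P x Q(1) T(1,3)] by blast
qed

text \<open>Without ties on the diagonal, \<open>permuted_diag_maximal\<close> makes a permutation
  garbling fix every label, contradicting \<open>T \<noteq> mat 1\<close>.\<close>

lemma preserves_strict_blackwell_dominant:
  "preserves (gram_score :: real^'d^'y \<Rightarrow> real) blackwell_dominant P_indep Q_reg_strict"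
  unfolding preserves_def
proof (intro ballI allI impI, elim conjE)
  fix P :: "real^'d^'y" and x xh xh' :: "'d list"
  assume P: "P \<in> P_indep" and x: "x \<noteq> []"
    and ord: "blackwell_dominant x xh xh'" and strict: "misreport x xh \<in> Q_reg_strict"
  obtain T where Q: "misreport x xh \<in> Q_reg" "misreport x xh' \<in> Q_reg"
    and T: "column_stochastic T" "T \<noteq> mat 1" "T ** cond_misreport x xh = cond_misreport x xh'"
    using ord by (auto simp: blackwell_dominant_def)
  have "\<not> permutation_matrix T"
  proof
    assume "permutation_matrix T"
    then obtain p where p: "p permutes UNIV" and Tp: "T = (\<chi> i j. if i = p j then 1 else 0)"
      by (auto simp: permutation_matrix_def)
    have "misreport x xh $ i $ inv p i = misreport x xh $ i $ i" for i
      using permuted_diag_maximal[OF Tp p garbling_transpose_misreport[OF x T(3)]] Q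
      by (simp add: Q_reg_def)
    then have "inv p i = i" for i
      using strict by (auto simp: Q_reg_strict_def) (metis less_irrefl)
    then have "p i = i" for i
      by (metis p permutes_inverses(1))
    then show False
      using T(2) by (simp add: Tp mat_def)
  qed
  then show "gram_score (P ** misreport x xh') < gram_score (P ** misreport x xh)"
    using gram_score_garbling_less[OF P x Q(1) T(1,3)] by blast
qed

section \<open>The distance ordering\<close>

lemma dist_order_imp_mismatches_less:
  fixes D :: "'d::finite \<Rightarrow> 'd \<Rightarrow> real"
  assumes D: "distance_function D" and L: "1 \<le> L"
    and ord: "dist_order (1 / (4 * L * distance_ratio D)) D x xh xh'"
  shows "4 * L * real (card {n. n < length x \<and> xh ! n \<noteq> x ! n}) <
         real (card {n. n < length x \<and> xh' ! n \<noteq> x ! n})"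
proof -
  define u v where "u = Min {D a b | a b. a \<noteq> b}" and "v = Max {D a b | a b. True}"
  have D0: "D a a = 0" for a
    using D by (simp add: distance_function_def)
  have fin: "finite {D a b | a b. R a b}" for R
    by (rule finite_subset[of _ "range (case_prod D)"]) auto
  \<comment> \<open>With a single label all distances vanish and the order would assert 0 < 0. Hence
    the minimum \<open>u\<close> is taken over a nonempty set.\<close>
  have "\<exists>a b :: 'd. a \<noteq> b"
  proof (rule ccontr)
    assume "\<nexists>a b :: 'd. a \<noteq> b"
    then have "D a b = 0" for a b
      using D0 by metis
    then show False
      using ord by (simp add: dist_order_def)
  qed
  then obtain a b :: 'd where ab: "a \<noteq> b"
    by blast
  have "u \<in> {D a b | a b. a \<noteq> b}"
    unfolding u_def using ab by (intro Min_in fin) auto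
  then have u: "0 < u"
    using D by (auto simp: distance_function_def)
  have le: "u \<le> D a b" if "a \<noteq> b" for a b
    unfolding u_def using that by (intro Min_le fin) auto
  have ge: "D a b \<le> v" for a b
    unfolding v_def by (intro Max_ge fin) auto
  have v: "0 < v"
    using u le[OF ab] ge[of a b] by simp
  have eq: "real (card {n. n < length x \<and> z ! n \<noteq> x ! n}) = (\<Sum>n<length x. of_bool (z ! n \<noteq> x ! n))" for z
  proof -
    have "{n. n < length x \<and> z ! n \<noteq> x ! n} = {..<length x} \<inter> {n. z ! n \<noteq> x ! n}"
      by auto
    then show ?thesis
      by simp
  qed
  let ?m = "\<lambda>z. real (card {n. n < length x \<and> z ! n \<noteq> x ! n})"
  \<comment> \<open>Matches cost 0 and mismatches between \<open>u\<close> and \<open>v\<close>, so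
    each distance sum lies between \<open>u\<close> and \<open>v\<close> times the number of
    mismatches. The ratio v/u built into the order absorbs this gap and leaves the factor
    4L.\<close>
  have "u * ?m xh \<le> (\<Sum>n<length x. D (xh ! n) (x ! n))"
    unfolding eq sum_distrib_left by (intro sum_mono) (auto simp: D0 le)
  also have "\<dots> < u / (4 * L * v) * (\<Sum>n<length x. D (xh' ! n) (x ! n))"
    using ord by (simp add: dist_order_def distance_ratio_def u_def v_def)
  also have "\<dots> \<le> u / (4 * L * v) * (v * ?m xh')"
    unfolding eq sum_distrib_left[of v] using u v L
    by (intro mult_left_mono sum_mono) (auto simp: D0 ge)
  also have "\<dots> = u * (?m xh' / (4 * L))"
    using v by simp
  finally have "?m xh < ?m xh' / (4 * L)"
    using u by (simp only: mult_less_cancel_left_pos)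
  then show ?thesis
    using L by (simp add: field_simps)
qed

text \<open>\<open>M\<close> is the largest label frequency: it is at least the average 1/d, and
  balancedness keeps every frequency at least M/L, hence positive.\<close>

lemma balanced_obtains_max:
  fixes x :: "'d::finite list"
  assumes x: "x \<noteq> []" and bal: "balanced L x" and L: "1 \<le> L"
  obtains M where "1 \<le> real CARD('d) * M" "0 < M"
    "\<And>i. label_freq x i \<le> M" "\<And>i. M \<le> L * label_freq x i" "\<And>i. 0 < label_freq x i"
proof -
  define M where "M = Max (range (label_freq x))"
  have "M \<in> range (label_freq x)"
    unfolding M_def by (intro Max_in) auto
  then obtain a where a: "M = label_freq x a"
    by auto
  have le: "label_freq x i \<le> M" for i
    unfolding M_def by simp
  have "1 \<le> (\<Sum>i::'d\<in>UNIV. M)"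
    unfolding sum_label_freq[OF x, symmetric] by (intro sum_mono le)
  then have d: "1 \<le> real CARD('d) * M"
    by simp
  have M: "0 < M"
    by (rule ccontr) (use d mult_nonneg_nonpos[of "real CARD('d)" M] in auto)
  have ge: "M \<le> L * label_freq x i" for i
    using bal by (simp add: a balanced_def)
  have "0 < label_freq x i" for i
    using less_le_trans[OF M ge[of i]] L by (simp add: zero_less_mult_iff)
  then show thesis
    using that d M le ge by blast
qed

text \<open>The deficit of column \<open>j\<close> is the misreported mass of label \<open>j\<close>
  divided by its frequency, which lies between M/L and M.\<close>

lemma sum_diag_deficit_bounds:
  fixes x :: "'d::finite list" and xh :: "'d list"
  defines "\<mu> \<equiv> real (card {n. n < length x \<and> xh ! n \<noteq> x ! n}) / real (length x)"
  assumes x: "x \<noteq> []" and M: "0 < M" "\<And>i. label_freq x i \<le> M" "\<And>i. M \<le> L * label_freq x i"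
    and pos: "\<And>i. 0 < label_freq x i"
  shows "\<mu> / M \<le> (\<Sum>j\<in>UNIV. 1 - cond_misreport x xh $ j $ j)" (is "_ \<le> ?E")
    and "(\<Sum>j\<in>UNIV. 1 - cond_misreport x xh $ j $ j) \<le> L * \<mu> / M"
proof -
  let ?m = "\<lambda>j. label_freq x j - misreport x xh $ j $ j"
  have E: "?E = (\<Sum>j\<in>UNIV. ?m j / label_freq x j)"
    using less_imp_neq[OF pos] by (intro sum.cong) (auto simp: cond_misreport_eq[OF x] diff_divide_distrib)
  have \<mu>: "\<mu> = (\<Sum>j\<in>UNIV. ?m j)"
    unfolding \<mu>_def using sum_misreport_diag[OF x] by simp
  have nonneg: "0 \<le> ?m j" for j
    using misreport_le_label_freq[of x xh j j] by simp
  show "\<mu> / M \<le> ?E"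
    unfolding E \<mu> sum_divide_distrib
    by (intro sum_mono divide_left_mono M nonneg mult_pos_pos pos)
  have "?m j / label_freq x j \<le> L * ?m j / M" for j
  proof -
    have "?m j * M \<le> ?m j * (L * label_freq x j)"
      by (intro mult_left_mono M nonneg)
    then show ?thesis
      using pos[of j] M(1) by (simp add: divide_le_eq pos_le_divide_eq mult_ac)
  qed
  then show "?E \<le> L * \<mu> / M"
    unfolding E \<mu> sum_divide_distrib sum_distrib_left by (intro sum_mono)
qed

lemma preserves_dist_order:
  fixes L :: real
  assumes L: "1 \<le> L" and D: "distance_function D"
  shows "preserves (gram_score :: real^'d^'y \<Rightarrow> real)
           (dist_order (1 / (4 * L * distance_ratio D)) D) P_indep
           (Q_bal L (1 / (64 * L\<^sup>2 * (real CARD('d))\<^sup>2)))"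
  unfolding preserves_def
proof (intro ballI allI impI, elim conjE)
  let ?d = "real CARD('d)" and ?\<delta> = "1 / (64 * L\<^sup>2 * (real CARD('d))\<^sup>2)"
  fix P :: "real^'d^'y" and x xh xh' :: "'d list"
  assume P: "P \<in> P_indep" and x: "x \<noteq> []"
    and ord: "dist_order (1 / (4 * L * distance_ratio D)) D x xh xh'"
    and Q': "misreport x xh' \<in> Q_bal L ?\<delta>"
  let ?\<mu> = "\<lambda>x xh. real (card {n. n < length x \<and> xh ! n \<noteq> x ! n}) / real (length x)"
  let ?E = "\<lambda>xh. \<Sum>j\<in>UNIV. 1 - cond_misreport x xh $ j $ j"
  obtain y yh where y: "misreport x xh' = misreport y yh" "y \<noteq> []" "balanced L y"
    and yh: "real (card {n. n < length y \<and> yh ! n \<noteq> y ! n}) \<le> real (length y) * ?\<delta>"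
    using Q' unfolding Q_bal_def by blast
  have freq: "label_freq x = label_freq y"
    using misreport_eq_imp_label_freq_eq[OF y(1)] .
  then have bal: "balanced L x"
    using y(3) by (simp add: balanced_def)
  \<comment> \<open>The bound from \<open>Q_bal\<close> concerns the witness \<open>y\<close>; it
    carries over to \<open>x\<close> because the matrix determines the fraction of
    misreports.\<close>
  have "?\<mu> x xh' = ?\<mu> y yh"
    unfolding sum_misreport_diag[OF x, symmetric] sum_misreport_diag[OF y(2), symmetric]
    by (simp add: freq y(1))
  also have "\<dots> \<le> ?\<delta>"
    using yh y(2) by (simp add: divide_le_eq mult.commute)
  finally have small: "?\<mu> x xh' \<le> ?\<delta>" .
  obtain M where d: "1 \<le> ?d * M" and M: "0 < M" "\<And>i. label_freq x i \<le> M"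
      "\<And>i. M \<le> L * label_freq x i" and pos: "\<And>i. 0 < label_freq x i"
    using balanced_obtains_max[OF x bal L] by metis
  have "4 * (L * ?\<mu> x xh) < ?\<mu> x xh'"
    using divide_strict_right_mono[OF dist_order_imp_mismatches_less[OF D L ord], of "real (length x)"] x
    by simp
  then have "4 * (L * ?\<mu> x xh / M) < ?\<mu> x xh' / M"
    using divide_strict_right_mono[OF _ M(1)] by fastforce
  then have less: "4 * ?E xh < ?E xh'"
    using sum_diag_deficit_bounds[OF x M pos, of xh] sum_diag_deficit_bounds[OF x M pos, of xh']
    by linarith
  \<comment> \<open>Since dM \<ge> 1 and Ld \<ge> 1, the constant gives L \<delta> = 1/(64 L d^2)
    \<le> 1/(2d) \<le> M/2.\<close>
  have "L * ?\<mu> x xh' / M \<le> 1 / 2"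
  proof -
    have "1 \<le> L * ?d"
      using L mult_mono[of 1 L 1 ?d] by (simp add: Suc_leI)
    then have "1 \<le> (32 * (L * ?d)) * (?d * M)"
      using d mult_mono[of 1 "32 * (L * ?d)" 1 "?d * M"] by simp
    then have "2 * L \<le> 64 * L\<^sup>2 * ?d\<^sup>2 * M"
      using mult_left_mono[of 1 "32 * (L * ?d) * (?d * M)" "2 * L"] L
      by (simp add: power2_eq_square mult_ac)
    then have "L * ?\<delta> \<le> M / 2"
      using L by (simp add: divide_le_eq mult_ac)
    moreover have "L * ?\<mu> x xh' \<le> L * ?\<delta>"
      using small L by (intro mult_left_mono) auto
    ultimately have "L * ?\<mu> x xh' \<le> 1 / 2 * M"
      by linarith
    then show ?thesis
      unfolding pos_divide_le_eq[OF M(1)] .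
  qed
  then have half: "?E xh' \<le> 1 / 2"
    using sum_diag_deficit_bounds(2)[OF x M pos, of xh'] by linarith
  have "\<bar>det (cond_misreport x xh')\<bar> < \<bar>det (cond_misreport x xh)\<bar>"
    by (intro abs_det_less_of_diag_deficit column_stochastic_cond_misreport x pos less half)
  moreover have "0 < (\<Prod>i\<in>UNIV. label_freq x i)"
    using pos by (simp add: prod_pos)
  ultimately show "gram_score (P ** misreport x xh') < gram_score (P ** misreport x xh)"
    unfolding gram_score_less_iff[OF P] by (simp add: det_misreport[OF x] abs_mult)
qed

theorem theorem4p2:
  fixes L :: real
  assumes "1 \<le> L"
  shows "preserves (gram_score :: real^'d^'y \<Rightarrow> real) exact_match P_indep Q_nonperm \<and>
         (preserves (gram_score :: real^'d^'y \<Rightarrow> real)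
            (asymmetric_part blackwell_dominant) P_indep Q_reg \<and>
          preserves (gram_score :: real^'d^'y \<Rightarrow> real)
            blackwell_dominant P_indep Q_reg_strict) \<and>
         (\<forall>D. distance_function D \<longrightarrow>
            preserves (gram_score :: real^'d^'y \<Rightarrow> real)
              (dist_order (1 / (4 * L * distance_ratio D)) D) P_indep
              (Q_bal L (1 / (64 * L\<^sup>2 * (real CARD('d))\<^sup>2))))"
  using preserves_exact_match preserves_asymmetric_blackwell_dominant
    preserves_strict_blackwell_dominant preserves_dist_order[OF assms]
  by blast

end
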